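(* Let $g=(g(1),g(2),\dots)$ be a sequence of nonzero integers, and let $f$ be the sequence defined by $f(n)=\prod_{d\mid n} g(d)$ (product over the positive divisors $d$ of $n$). Then $f$ is binomid at every level: for every integer $c\ge 0$, the column sequence $C_c=(C_c(N))_{N\ge1}$ defined by $C_c(N)=\left[{N+c-1 \atop c}\right]_f$ is binomid.
   Context: For a sequence $h=(h_1,h_2,\dots)$ of nonzero rational numbers and integers $0\le k\le n$, the $h$-binomial coefficient is $\left[{n\atop k}\right]_h=\dfrac{h_nh_{n-1}\cdots h_{n-k+1}}{h_kh_{k-1}\cdots h_1}$ (equal to $1$ when $k=0$). The sequence $h$ is called binomid if every $\left[{n\atop k}\right]_h$ with $0\le k\le n$ is an integer. A sequence of the form $f(n)=\prod_{d\mid n}g(d)$ with $g$ an integer sequence is called a divisor-product. *)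

theory Defs
  imports Complex_Main
begin

text \<open>A sequence \<open>(h 1, h 2, \<dots>)\<close> is a function on \<^typ>\<open>nat\<close> whose value at \<open>0\<close> is never used.\<close>

definition hbinom :: "(nat \<Rightarrow> rat) \<Rightarrow> nat \<Rightarrow> nat \<Rightarrow> rat" where
  "hbinom h n k = (\<Prod>i<k. h (n - i)) / (\<Prod>i=1..k. h i)"

text \<open>The binomid property is only meaningful for sequences of nonzero rationals, so
  nonvanishing is part of the definition; without it, \<open>x / 0 = 0\<close> would allow
  spurious instances. The natural subtraction in \<^const>\<open>hbinom\<close> does not truncate for \<open>k \<le> n\<close>.\<close>

definition binomid :: "(nat \<Rightarrow> rat) \<Rightarrow> bool" where
  "binomid h \<longleftrightarrow> (\<forall>n\<ge>1. h n \<noteq> 0) \<and> (\<forall>n k. k \<le> n \<longrightarrow> hbinom h n k \<in> \<int>)"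

definition column :: "(nat \<Rightarrow> rat) \<Rightarrow> nat \<Rightarrow> nat \<Rightarrow> rat" where
  "column h c N = hbinom h (N + c - 1) c"

definition divisor_product :: "(nat \<Rightarrow> int) \<Rightarrow> nat \<Rightarrow> int" where
  "divisor_product g n = (\<Prod>d | d dvd n. g d)"

end

theory Submission
  imports Defs
begin

text \<open>
  Fix \<open>M\<close> and write \<open>f j\<close> for \<open>1 \<le> j \<le> M\<close> as the product over \<open>d \<le> M\<close> of
  \<open>g d\<close> to the power 1 if \<open>d\<close> divides \<open>j\<close> and 0 otherwise. Whenever a sequence is such a product
  of powers \<open>g d ^ a d j\<close>, its \<open>h\<close>-binomial coefficient is the product of
  \<open>g d ^ (A d n - A d (n - k) - A d k)\<close>, where \<open>A d\<close> is the summatory function of \<open>a d\<close>; so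
  superadditivity of every \<open>A d\<close> yields integrality. Applied to \<open>f\<close>, where
  \<open>A d n = n div d\<close>, this gives the exponents of the column \<open>C\<^sub>c\<close>: the exponent of \<open>g d\<close> in
  \<open>C\<^sub>c(N)\<close> is the carry of \<open>(N - 1) mod d + c mod d\<close> modulo \<open>d\<close>. As a function of \<open>N\<close> it has
  period \<open>d\<close>, and each period consists of zeros followed by \<open>c mod d\<close> ones, so an initial window
  contains the fewest ones among all windows of its length. Hence its summatory function is
  superadditive as well, and the argument applies a second time.
\<close>

lemma hbinom_eq_prod_quotient:
  assumes "k \<le> n" and nz: "\<And>j. 1 \<le> j \<Longrightarrow> j \<le> n \<Longrightarrow> h j \<noteq> 0"
  shows "hbinom h n k = (\<Prod>j=1..n. h j) / ((\<Prod>j=1..n-k. h j) * (\<Prod>j=1..k. h j))"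
proof -
  have "(\<Prod>i<k. h (n - i)) = (\<Prod>j\<in>{n-k+1..n}. h j)"
    using \<open>k \<le> n\<close> by (intro prod.reindex_bij_witness[of _ "\<lambda>j. n - j" "\<lambda>i. n - i"]) auto
  moreover have "(\<Prod>j=1..n. h j) = (\<Prod>j=1..n-k. h j) * (\<Prod>j\<in>{n-k+1..n}. h j)"
    using \<open>k \<le> n\<close> prod.ub_add_nat[of 1 "n - k" h k] by simp
  moreover have "(\<Prod>j=1..n-k. h j) \<noteq> 0"
    using nz by auto
  ultimately show ?thesis
    by (simp add: hbinom_def)
qed

text \<open>\<open>A\<close> is a parameter, so that closed forms of the partial sums of
  \<open>a\<close> can be substituted for it. By \<open>super\<close>, the truncated subtractions in
  the exponents are exact.\<close>

lemma hbinom_prod_powers: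
  fixes G :: "'a \<Rightarrow> rat" and a :: "'a \<Rightarrow> nat \<Rightarrow> nat"
  assumes "k \<le> n" and "finite D" and G: "\<And>d. d \<in> D \<Longrightarrow> G d \<noteq> 0"
    and h: "\<And>j. 1 \<le> j \<Longrightarrow> j \<le> n \<Longrightarrow> h j = (\<Prod>d\<in>D. G d ^ a d j)"
    and A: "\<And>d m. d \<in> D \<Longrightarrow> A d m = (\<Sum>j=1..m. a d j)"
    and super: "\<And>d. d \<in> D \<Longrightarrow> A d (n - k) + A d k \<le> A d n"
  shows "hbinom h n k = (\<Prod>d\<in>D. G d ^ (A d n - A d (n - k) - A d k))"
proof -
  have P: "(\<Prod>j=1..m. h j) = (\<Prod>d\<in>D. G d ^ A d m)" if "m \<le> n" for m
  proof -
    have "(\<Prod>j=1..m. h j) = (\<Prod>j=1..m. \<Prod>d\<in>D. G d ^ a d j)"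
      using h that by (intro prod.cong) auto
    also have "\<dots> = (\<Prod>d\<in>D. \<Prod>j=1..m. G d ^ a d j)"
      by (rule prod.swap)
    also have "\<dots> = (\<Prod>d\<in>D. G d ^ A d m)"
      by (intro prod.cong) (auto simp: power_sum A)
    finally show ?thesis .
  qed
  have nz: "h j \<noteq> 0" if "1 \<le> j" "j \<le> n" for j
    using h[OF that] G \<open>finite D\<close> by simp
  have "hbinom h n k
      = (\<Prod>d\<in>D. G d ^ A d n) / ((\<Prod>d\<in>D. G d ^ A d (n - k)) * (\<Prod>d\<in>D. G d ^ A d k))"
    using hbinom_eq_prod_quotient[OF \<open>k \<le> n\<close> nz] P[of n] P[of "n - k"] P[of k] \<open>k \<le> n\<close> by simp
  also have "\<dots> = (\<Prod>d\<in>D. G d ^ A d n / (G d ^ A d (n - k) * G d ^ A d k))"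
    by (simp add: prod_dividef prod.distrib)
  also have "\<dots> = (\<Prod>d\<in>D. G d ^ (A d n - A d (n - k) - A d k))"
  proof (rule prod.cong[OF refl])
    fix d assume d: "d \<in> D"
    have "A d n = (A d n - A d (n - k) - A d k) + (A d (n - k) + A d k)"
      using super[OF d] by linarith
    then have "G d ^ A d n
        = G d ^ (A d n - A d (n - k) - A d k) * (G d ^ A d (n - k) * G d ^ A d k)"
      by (metis power_add)
    then show "G d ^ A d n / (G d ^ A d (n - k) * G d ^ A d k)
        = G d ^ (A d n - A d (n - k) - A d k)"
      using G[OF d] by simp
  qed
  finally show ?thesis .
qed

lemma sum_dvd_indicator_eq_div:
  assumes "d \<ge> 1"
  shows "(\<Sum>j=1..m. if d dvd j then 1 else 0) = m div (d::nat)"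
  using assms by (induction m) (auto simp: div_Suc dvd_eq_mod_eq_0)

lemma div_mod_carry:
  fixes x y d :: nat
  assumes "x < d" "y < d" "d \<le> x + y"
  shows "(x + y) div d = 1" and "(x + y) mod d = x + y - d"
  using assms by (simp_all add: le_div_geq le_mod_geq)

lemma add_div_diff_eq_carry:
  fixes m c d :: nat
  assumes "d \<ge> 1"
  shows "(m + c) div d - m div d - c div d = (if d \<le> m mod d + c mod d then 1 else 0)"
proof -
  have "m mod d < d" "c mod d < d"
    using assms by simp_all
  then have "(m mod d + c mod d) div d = (if d \<le> m mod d + c mod d then 1 else 0)"
    using div_mod_carry(1)[of "m mod d" d "c mod d"] by auto
  then show ?thesis
    by (simp add: div_add1_eq[of m c])
qed

text \<open>Each full period contributes \<open>c mod d\<close> carries. In the incomplete one only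
  the residues from \<open>d - c mod d\<close> on carry; truncated subtraction gives 0 until they
  are reached.\<close>

lemma sum_carries:
  fixes c d n :: nat
  assumes "d \<ge> 1"
  shows "(\<Sum>m<n. if d \<le> m mod d + c mod d then 1 else 0)
       = (n div d) * (c mod d) + (n mod d + c mod d - d)"
proof (induction n)
  case 0
  then show ?case using assms by (simp add: less_imp_le)
next
  case (Suc n)
  have "n mod d < d" "c mod d < d"
    using assms by simp_all
  with Suc show ?case
    by (auto simp: div_Suc mod_Suc)
qed

lemma sum_carries_superadditive:
  fixes a b d r :: nat
  assumes "r < d"
  shows "((a div d) * r + (a mod d + r - d)) + ((b div d) * r + (b mod d + r - d))
       \<le> ((a + b) div d) * r + ((a + b) mod d + r - d)"
proof -
  have lt: "a mod d < d" "b mod d < d"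
    using assms by simp_all
  show ?thesis
  proof (cases "a mod d + b mod d < d")
    case True
    then have "(a + b) div d = a div d + b div d" "(a + b) mod d = a mod d + b mod d"
      by (simp add: div_add1_eq[of a b], metis mod_add_eq mod_less)
    then show ?thesis
      using lt assms by (simp add: distrib_right)
  next
    case False
    then have "(a mod d + b mod d) div d = 1" "(a mod d + b mod d) mod d = a mod d + b mod d - d"
      using div_mod_carry lt by simp_all
    then have "(a + b) div d = a div d + b div d + 1" "(a + b) mod d = a mod d + b mod d - d"
      by (simp add: div_add1_eq[of a b], metis mod_add_eq)
    \<comment> \<open>The wrap-around completes one more period, worth \<open>r\<close>. If both
      terms on the left are positive, their sum is
      \<open>r + (a mod d + b mod d + r - 2 * d)\<close> over the integers; otherwise it is at most
      \<open>r\<close>.\<close>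
    moreover have "(a mod d + r - d) + (b mod d + r - d) \<le> r + (a mod d + b mod d - d + r - d)"
      using False lt assms by linarith
    ultimately show ?thesis
      by (simp add: distrib_right)
  qed
qed

text \<open>The bound \<open>M\<close> provides one index set for all \<open>j\<close>, as needed to
  interchange the products over \<open>j\<close> and \<open>d\<close>.\<close>

lemma divisor_product_eq_prod_powers:
  assumes "1 \<le> j" "j \<le> M"
  shows "divisor_product g j = (\<Prod>d=1..M. g d ^ (if d dvd j then 1 else 0))"
proof -
  have "{d. d dvd j} = {d \<in> {1..M}. d dvd j}"
    using assms by (auto dest: dvd_imp_le intro: Suc_leI dvd_pos_nat)
  then have "divisor_product g j = (\<Prod>d\<in>{1..M}. if d dvd j then g d else 1)"
    by (simp only: divisor_product_def prod.inter_filter finite_atLeastAtMost)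
  also have "\<dots> = (\<Prod>d=1..M. g d ^ (if d dvd j then 1 else 0))"
    by (intro prod.cong) auto
  finally show ?thesis .
qed

lemma column_divisor_product:
  fixes g :: "nat \<Rightarrow> int" and f :: "nat \<Rightarrow> rat"
  assumes g_nonzero: "\<And>n. n \<ge> 1 \<Longrightarrow> g n \<noteq> 0"
    and f_def: "\<And>n. n \<ge> 1 \<Longrightarrow> f n = of_int (divisor_product g n)"
    and "1 \<le> N" "N + c - 1 \<le> M"
  shows "column f c N
       = (\<Prod>d=1..M. of_int (g d) ^ (if d \<le> (N - 1) mod d + c mod d then 1 else 0))"
proof -
  \<comment> \<open>The top index \<open>N + c - 1\<close> becomes \<open>n + c\<close>, free of
    subtraction.\<close>
  obtain n where N: "N = Suc n"
    using \<open>1 \<le> N\<close> by (cases N) auto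
  have "hbinom f (n + c) c
      = (\<Prod>d=1..M. of_int (g d) ^ ((n + c) div d - (n + c - c) div d - c div d))"
  proof (rule hbinom_prod_powers[where A = "\<lambda>d m. m div d"])
    show "f j = (\<Prod>d=1..M. of_int (g d) ^ (if d dvd j then 1 else 0))"
      if "1 \<le> j" "j \<le> n + c" for j
      using that f_def[of j] divisor_product_eq_prod_powers[of j M g] \<open>N + c - 1 \<le> M\<close> N by simp
    show "m div d = (\<Sum>j=1..m. if d dvd j then 1 else 0)" if "d \<in> {1..M}" for d m
      using that sum_dvd_indicator_eq_div[of d m] by simp
    show "(n + c - c) div d + c div d \<le> (n + c) div d" for d
      by (simp add: div_add1_eq[of n c])
  qed (use g_nonzero in auto)
  also have "\<dots> = (\<Prod>d=1..M. of_int (g d) ^ (if d \<le> n mod d + c mod d then 1 else 0))"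
    by (rule prod.cong[OF refl]) (simp only: add_div_diff_eq_carry add_diff_cancel_right' atLeastAtMost_iff)
  finally show ?thesis
    by (simp add: column_def N)
qed

theorem theorem3p5:
  fixes g :: "nat \<Rightarrow> int" and f :: "nat \<Rightarrow> rat"
  assumes g_nonzero: "\<And>n. n \<ge> 1 \<Longrightarrow> g n \<noteq> 0"
    and f_def: "\<And>n. n \<ge> 1 \<Longrightarrow> f n = of_int (divisor_product g n)"
  shows "\<forall>c. binomid (column f c)"
proof
  fix c
  note column_eq = column_divisor_product[of g f, OF g_nonzero f_def]
  have "column f c n \<noteq> 0" if "n \<ge> 1" for n
    using column_eq[of n c "n + c"] that g_nonzero by auto
  moreover have "hbinom (column f c) n k \<in> \<int>" if "k \<le> n" for n k
  proof -
    let ?E = "\<lambda>d m. (m div d) * (c mod d) + (m mod d + c mod d - d)"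
    have "hbinom (column f c) n k
        = (\<Prod>d=1..n+c. of_int (g d) ^ (?E d n - ?E d (n - k) - ?E d k))"
    proof (rule hbinom_prod_powers[OF that])
      show "column f c j
          = (\<Prod>d=1..n+c. of_int (g d) ^ (if d \<le> (j - 1) mod d + c mod d then 1 else 0))"
        if "1 \<le> j" "j \<le> n" for j
        using column_eq[of j c "n + c"] that by simp
      show "?E d m = (\<Sum>j=1..m. if d \<le> (j - 1) mod d + c mod d then 1 else 0)"
        if "d \<in> {1..n+c}" for d m
      proof -
        \<comment> \<open>The carry depends on \<open>j - 1\<close>, so the window starts at residue
          0, the beginning of a period.\<close>
        have "(\<Sum>j=1..m. if d \<le> (j - 1) mod d + c mod d then 1 else 0)
            = (\<Sum>i<m. if d \<le> i mod d + c mod d then 1 else (0::nat))"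
          by (intro sum.reindex_bij_witness[of _ Suc "\<lambda>j. j - 1"]) auto
        then show ?thesis
          using that sum_carries[of d c m] by simp
      qed
      show "?E d (n - k) + ?E d k \<le> ?E d n" if "d \<in> {1..n+c}" for d
        using that \<open>k \<le> n\<close> sum_carries_superadditive[of "c mod d" d "n - k" k] by simp
    qed (use g_nonzero in auto)
    also have "\<dots> = of_int (\<Prod>d=1..n+c. g d ^ (?E d n - ?E d (n - k) - ?E d k))"
      by simp
    finally show ?thesis
      by (simp only: Ints_of_int)
  qed
  ultimately show "binomid (column f c)"
    by (simp add: binomid_def)
qed

end
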